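(* Let $k,\kappa$ be positive integers and $d$ an integer such that $d>2\kappa$. Let $\varphi:[-1,1]\times[0,\infty)\to\mathbb{R}$ be a function in $\mathcal{P}(\mathbb{S}^d\times\mathbb{R}^k)$ such that $u\mapsto I_1^{\kappa-1}\varphi(u,t)$ is integrable over $[-1,1]$ for each $t\in[0,\infty)$. Then $I_1^\kappa\varphi$ has a representation as a Gegenbauer series $$I_1^\kappa\varphi(x,t)=\sum_{n=0}^\infty\tilde f_n^{d,\kappa}(t)\,C_n^{(d-2\kappa-1)/2}(x),\qquad (x,t)\in[-1,1]\times[0,\infty),$$ where $$\tilde f_n^{d,\kappa}(t):=\begin{cases}\tau^{d,\kappa}\sum_{i=0}^\infty(-1)^i\chi_i^{n,d,\kappa}f_i^d(t),& n=0,1,\dots,\kappa-1,\\[2pt] \tau^{d,\kappa}f_{n-\kappa}^d(t),& n\ge\kappa,\end{cases}$$ the functions $f_n^d$ are the $d$-Schoenberg functions of $\varphi$, the positive constant $\tau^{d,\kappa}$ is $\tau^{d,\kappa}:=\big(\prod_{j=1}^\kappa\delta_{(d-2j+1)/2}\big)^{-1}$, and the coefficients, defined recursively in $\kappa$ for $i\ge0$ by $$\chi_i^{0,d,\kappa}:=\sum_{j=1}^{\kappa-1}(-1)^{j+1}\chi_i^{j-1,d,\kappa-1}C_j^{(d-2\kappa-1)/2}(1)-(-1)^{\kappa}C_{i+\kappa}^{(d-2\kappa-1)/2}(1),$$ $$\chi_i^{n,d,\kappa}:=\chi_i^{n-1,d,\kappa-1},\qquad n=1,2,\dots,\kappa-1,$$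 satisfy $$|\chi_i^{n,d,\kappa}|\le\Upsilon^{n,d,\kappa}\,C_i^{(d-1)/2}(1),\qquad n=0,1,\dots,\kappa-1,\quad i=0,1,2,\dots,$$ where, for each $n=0,\dots,\kappa-1$ and each positive integer $\kappa$, $\Upsilon^{n,d,\kappa}$ is a positive constant that depends only on $d$. Moreover, $\sum_{n=0}^\infty\tilde f_n^{d,\kappa}(0)\,C_n^{(d-2\kappa-1)/2}(1)<\infty$.
   Context: $\mathbb{S}^d$ is the unit sphere of $\mathbb{R}^{d+1}$, with geodesic distance $\theta(x,x')=\arccos\langle x,x'\rangle$; $\|\cdot\|$ is the Euclidean norm on $\mathbb{R}^k$. A function $C:Z\times Z\to\mathbb{R}$ is positive definite if $\sum_{i,j=1}^N a_i\,C(z_i,z_j)\,a_j\ge 0$ for all finite systems of reals $a_i$ and points $z_i\in Z$. $\mathcal{P}(\mathbb{S}^d\times\mathbb{R}^k)$ is the class of continuous $\varphi:[-1,1]\times[0,\infty)\to\mathbb{R}$ such that $C((x,y),(x',y'))=\varphi(\cos\theta(x,x'),\|y-y'\|)$ is positive definite on $\mathbb{S}^d\times\mathbb{R}^k$. $\mathcal{P}(\mathbb{R}^k)$ is the class of continuous $f:[0,\infty)\to\mathbb{R}$ such that $f(\|y-y'\|)$ is positive definite on $\mathbb{R}^k$. $C_n^\lambda$ are the (unnormalized) Gegenbauer polynomials: for $\lambda>0$, $\sum_n C_n^\lambda(x)s^n=(1-2xs+s^2)^{-\lambda}$; for $\lambda=0$, $C_0^0=1$ and $C_n^0(\cos\theta)=\frac2n\cos(n\theta)$,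 $n\ge1$. Set $\delta_\lambda=2\lambda$ for $\lambda>-1/2$, $\lambda\ne0$, and $\delta_0=2$. Known fact used as definition: $\varphi\in\mathcal{P}(\mathbb{S}^d\times\mathbb{R}^k)$ if and only if it has a (unique, uniformly convergent) expansion $\varphi(x,t)=\sum_{n=0}^\infty f_n^d(t)C_n^{(d-1)/2}(x)$ with $f_n^d\in\mathcal{P}(\mathbb{R}^k)$ and $\sum_n f_n^d(0)C_n^{(d-1)/2}(1)<\infty$; the $f_n^d$ are the $d$-Schoenberg functions of $\varphi$. The operator $I_1$: $I_1\varphi(x,t):=\int_{-1}^x\varphi(u,t)\,du$ for $(x,t)\in[-1,1]\times[0,\infty)$, when $\varphi(\cdot,t)$ is integrable over $[-1,1]$ for each $t$; $I_1^0\varphi:=\varphi$ and $I_1^\kappa\varphi:=I_1(I_1^{\kappa-1}\varphi)$.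
   Formalization: The constant τ is taken as the inverse of the product of δ_{(d-2j-1)/2} over j=1..κ instead of δ_{(d-2j+1)/2}; the printed index fails for d=4, κ=1, φ=1, where it gives (x+1)/3 instead of x+1. *)

theory Defs
  imports "HOL-Analysis.Analysis"
begin

section \<open>Positive definite kernels\<close>

definition positive_definite_on :: "'z set \<Rightarrow> ('z \<Rightarrow> 'z \<Rightarrow> real) \<Rightarrow> bool" where
  "positive_definite_on Z C \<longleftrightarrow>
     (\<forall>N (a :: nat \<Rightarrow> real) z. (\<forall>i<N. z i \<in> Z) \<longrightarrow>
        0 \<le> (\<Sum>i<N. \<Sum>j<N. a i * C (z i) (z j) * a j))"

text \<open>
  Functions on \<open>[0,\<infinity>)\<close> and on \<open>[-1,1] \<times> [0,\<infinity>)\<close> are represented by total functions whose values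
  outside these domains are never used. The space \<open>\<real>\<^sup>k\<close> is \<open>real ^ 'k\<close>, and the sphere
  \<open>S\<^sup>d\<close> is \<open>sphere 0 1\<close> in \<open>real ^ 'm\<close> with \<open>CARD('m) = d + 1\<close>.
\<close>

definition pd_euclidean :: "'k::finite itself \<Rightarrow> (real \<Rightarrow> real) set" where
  "pd_euclidean TYPE('k) =
     {f. continuous_on {0..} f \<and>
         positive_definite_on UNIV (\<lambda>(y :: real ^ 'k) y'. f (norm (y - y')))}"

definition geodesic_dist :: "'a::real_inner \<Rightarrow> 'a \<Rightarrow> real" where
  "geodesic_dist x x' = arccos (x \<bullet> x')"

definition pd_sphere_euclidean ::
    "'m::finite itself \<Rightarrow> 'k::finite itself \<Rightarrow> (real \<Rightarrow> real \<Rightarrow> real) set" where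
  "pd_sphere_euclidean TYPE('m) TYPE('k) =
     {\<phi>. continuous_on ({-1..1} \<times> {0..}) (\<lambda>(x, t). \<phi> x t) \<and>
         positive_definite_on (sphere (0 :: real ^ 'm) 1 \<times> (UNIV :: (real ^ 'k) set))
           (\<lambda>(x, y) (x', y'). \<phi> (cos (geodesic_dist x x')) (norm (y - y')))}"

section \<open>Gegenbauer polynomials\<close>

text \<open>
  For \<open>\<mu> \<noteq> 0\<close> the generating function \<open>(1 - 2xs + s\<^sup>2) powr -\<mu>\<close> is read as a formal power series
  in \<open>s\<close>: the binomial series \<open>(1 + u) powr -\<mu>\<close> composed with \<open>u = s\<^sup>2 - 2xs\<close>.
  For \<open>\<mu> = 0\<close> the substitution \<open>x = cos \<theta>\<close> restricts the definition to \<open>x \<in> [-1,1]\<close>.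
\<close>

definition gegenbauer :: "real \<Rightarrow> nat \<Rightarrow> real \<Rightarrow> real" where
  "gegenbauer \<mu> n x =
     (if \<mu> = 0 then (if n = 0 then 1 else 2 / real n * cos (real n * arccos x))
      else fps_nth (fps_binomial (-\<mu>) oo (fps_X ^ 2 - fps_const (2 * x) * fps_X)) n)"

section \<open>Schoenberg functions\<close>

definition schoenberg_functions ::
    "'k::finite itself \<Rightarrow> nat \<Rightarrow> (real \<Rightarrow> real \<Rightarrow> real) \<Rightarrow> (nat \<Rightarrow> real \<Rightarrow> real) \<Rightarrow> bool" where
  "schoenberg_functions TYPE('k) d \<phi> f \<longleftrightarrow>
     (\<forall>n. f n \<in> pd_euclidean TYPE('k)) \<and>
     summable (\<lambda>n. f n 0 * gegenbauer ((real d - 1) / 2) n 1) \<and>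
     uniform_limit ({-1..1} \<times> {0..})
       (\<lambda>N (x, t). \<Sum>n<N. f n t * gegenbauer ((real d - 1) / 2) n x)
       (\<lambda>(x, t). \<phi> x t) sequentially"

section \<open>The integration operator and the coefficients of its iterates\<close>

definition I1 :: "(real \<Rightarrow> real \<Rightarrow> real) \<Rightarrow> real \<Rightarrow> real \<Rightarrow> real" where
  "I1 \<phi> x t = integral {-1..x} (\<lambda>u. \<phi> u t)"

definition delta :: "real \<Rightarrow> real" where
  "delta \<mu> = (if \<mu> = 0 then 2 else 2 * \<mu>)"

text \<open>
  Since \<open>C\<^sub>n\<^sup>\<mu>\<close> is \<open>1 / delta (\<mu> - 1)\<close> times the derivative of the Gegenbauer polynomial of degree
  \<open>n + 1\<close> and order \<open>\<mu> - 1\<close>, the \<open>j\<close>-th integration, which lowers the order from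
  \<open>(d - 2j + 1) / 2\<close> to \<open>(d - 2j - 1) / 2\<close>, contributes the factor \<open>1 / delta ((d - 2j - 1) / 2)\<close>.
  The source prints the index \<open>(d - 2j + 1) / 2\<close>, a misprint: for \<open>d = 4\<close>, one integration and
  \<open>\<phi> = 1\<close> it would give \<open>(x + 1) / 3\<close> instead of \<open>x + 1\<close>.
\<close>

definition tau :: "nat \<Rightarrow> nat \<Rightarrow> real" where
  "tau d \<kappa> = inverse (\<Prod>j=1..\<kappa>. delta ((real d - 2 * real j - 1) / 2))"

text \<open>
  \<open>chi d \<kappa> n i\<close> is \<open>\<chi>\<close> with subscript \<open>i\<close> and superscripts \<open>n, d, \<kappa>\<close>. It is meaningful only for
  \<open>n < \<kappa>\<close>; the equation for \<open>\<kappa> = 0\<close> is a dummy that is never reached from there.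
\<close>

fun chi :: "nat \<Rightarrow> nat \<Rightarrow> nat \<Rightarrow> nat \<Rightarrow> real" where
  "chi d 0 n i = 0"
| "chi d (Suc \<kappa>) 0 i =
     (\<Sum>j=1..\<kappa>. (-1) ^ (j + 1) * chi d \<kappa> (j - 1) i
                  * gegenbauer ((real d - 2 * real (Suc \<kappa>) - 1) / 2) j 1)
     - (-1) ^ Suc \<kappa> * gegenbauer ((real d - 2 * real (Suc \<kappa>) - 1) / 2) (i + Suc \<kappa>) 1"
| "chi d (Suc \<kappa>) (Suc n) i = chi d \<kappa> n i"

definition tilde_f :: "nat \<Rightarrow> nat \<Rightarrow> (nat \<Rightarrow> real \<Rightarrow> real) \<Rightarrow> nat \<Rightarrow> real \<Rightarrow> real" where
  "tilde_f d \<kappa> f n t =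
     (if n < \<kappa> then tau d \<kappa> * (\<Sum>i. (-1) ^ i * chi d \<kappa> n i * f i t)
      else tau d \<kappa> * f (n - \<kappa>) t)"

end

theory Submission
  imports Defs
begin

text \<open>
  The series of \<open>\<phi>\<close> is integrated term by term, \<open>\<kappa>\<close> times. For \<open>\<nu> \<ge> 0\<close> the polynomial
  \<open>C\<^sub>n\<^sub>+\<^sub>1\<^sup>\<nu>\<close> has derivative \<open>delta \<nu> * C\<^sub>n\<^sup>\<nu>\<^sup>+\<^sup>1\<close> and parity \<open>(-1) ^ (n + 1)\<close>, so the integral of
  \<open>C\<^sub>n\<^sup>\<nu>\<^sup>+\<^sup>1\<close> from \<open>-1\<close> to \<open>x\<close> is \<open>(C\<^sub>n\<^sub>+\<^sub>1\<^sup>\<nu> x + (-1) ^ n * C\<^sub>n\<^sub>+\<^sub>1\<^sup>\<nu> 1) / delta \<nu>\<close>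
  (\<open>gegenbauer_has_integral\<close>). One integration therefore raises degrees by one, divides
  coefficients by \<open>delta \<nu>\<close>, and creates one new term of degree \<open>0\<close>, the sum of the constants
  \<open>(-1) ^ n * C\<^sub>n\<^sub>+\<^sub>1\<^sup>\<nu> 1\<close> weighted by the new coefficients. The recursion defining \<open>chi\<close> records exactly this
  (\<open>tilde_f_Suc_Suc\<close>, \<open>tilde_f_Suc_0\<close>).

  Convergence rests on two estimates. On \<open>[-1,1]\<close>, \<open>\<bar>C\<^sub>n\<^sup>\<nu> x\<bar> \<le> C\<^sub>n\<^sup>\<nu> 1\<close> (\<open>abs_gegenbauer_le\<close>), because
  \<open>C\<^sub>n\<^sup>\<nu> (cos \<theta>)\<close> is a cosine sum with nonnegative coefficients; this justifies termwise integration
  by the Weierstrass test. Moreover \<open>C\<^sub>n\<^sub>+\<^sub>1\<^sup>\<nu> 1 \<le> delta \<nu> * C\<^sub>n\<^sup>\<nu>\<^sup>+\<^sup>1 1\<close> (\<open>gegenbauer_at_1_Suc_le\<close>),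
  so that absolute summability of the coefficients against the values at \<open>1\<close> is inherited by the
  integrated series; the same inequality, iterated, bounds \<open>chi\<close>. The initial absolute summability
  holds because positive definite functions satisfy \<open>\<bar>f t\<bar> \<le> f 0\<close>.
\<close>

section \<open>Recurrence and cosine expansion of Gegenbauer polynomials\<close>

text \<open>
  The series \<open>(1 - b s + s\<^sup>2) powr -\<mu>\<close> satisfies the differential equation in the hypothesis, which
  determines all coefficients from the constant one. The field is kept general because the
  lemma is applied to real power series and to products of complex ones.
\<close>
lemma gen_fun_ODE_recurrence:
  fixes G :: "'a::field_char_0 fps" and b \<mu> :: 'a
  assumes ode: "(1 - fps_const b * fps_X + fps_X ^ 2) * fps_deriv G
      = fps_const \<mu> * (fps_const b - 2 * fps_X) * G"
  shows "fps_nth G 1 = \<mu> * b * fps_nth G 0"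
    and "of_nat (n + 2) * fps_nth G (n + 2)
      = b * (of_nat (n + 1) + \<mu>) * fps_nth G (n + 1) - (of_nat n + 2 * \<mu>) * fps_nth G n"
proof -
  have e: "fps_deriv G - fps_const b * (fps_X * fps_deriv G) + fps_X * (fps_X * fps_deriv G)
      = fps_const (\<mu> * b) * G - fps_const (2 * \<mu>) * (fps_X * G)"
    using ode by (simp add: algebra_simps power2_eq_square flip: fps_const_mult fps_numeral_fps_const)
  from arg_cong[OF e, of "\<lambda>F. fps_nth F 0"]
  show "fps_nth G 1 = \<mu> * b * fps_nth G 0"
    by simp
  from arg_cong[OF e, of "\<lambda>F. fps_nth F (Suc n)"]
  show "of_nat (n + 2) * fps_nth G (n + 2)
      = b * (of_nat (n + 1) + \<mu>) * fps_nth G (n + 1) - (of_nat n + 2 * \<mu>) * fps_nth G n"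
    by (cases n) (simp_all add: algebra_simps)
qed

lemma gegenbauer_ODE:
  fixes x \<mu> :: real
  defines "G \<equiv> fps_binomial (-\<mu>) oo (fps_X ^ 2 - fps_const (2 * x) * fps_X)"
  shows "(1 - fps_const (2 * x) * fps_X + fps_X ^ 2) * fps_deriv G
      = fps_const \<mu> * (fps_const (2 * x) - 2 * fps_X) * G"
proof -
  define h where "h = (fps_X ^ 2 - fps_const (2 * x) * fps_X :: real fps)"
  have h0: "fps_nth h 0 = 0"
    by (simp add: h_def)
  define B where "B = fps_binomial (-\<mu>)"
  have "(1 + fps_X) * fps_deriv B = fps_const (-\<mu>) * B"
    unfolding B_def fps_binomial_deriv
    by (simp add: fps_divide_unit mult.commute[of _ "inverse _"] inverse_mult_eq_1 flip: mult.assoc)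
  hence "((1 + fps_X) * fps_deriv B) oo h = (fps_const (-\<mu>) * B) oo h"
    by simp
  hence B': "(1 + h) * (fps_deriv B oo h) = fps_const (-\<mu>) * (B oo h)"
    using h0 by (simp add: fps_compose_mult_distrib fps_compose_add_distrib)
  have dh: "fps_deriv h = 2 * fps_X - fps_const (2 * x)"
    by (simp add: h_def power2_eq_square)
  have "(1 + h) * fps_deriv (B oo h) = (1 + h) * (fps_deriv B oo h) * fps_deriv h"
    using h0 by (simp add: fps_compose_deriv mult.assoc)
  also have "\<dots> = fps_const \<mu> * (fps_const (2 * x) - 2 * fps_X) * (B oo h)"
    unfolding B' dh by (simp add: algebra_simps flip: fps_const_neg)
  finally show ?thesis
    by (simp add: G_def B_def[symmetric] h_def[symmetric]) (simp add: h_def algebra_simps)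
qed

lemma gegenbauer_degree_0:
  "gegenbauer \<mu> 0 x = 1"
  by (simp add: gegenbauer_def)

lemma gegenbauer_degree_1:
  assumes "\<mu> \<noteq> 0"
  shows "gegenbauer \<mu> 1 x = 2 * \<mu> * x"
  using gen_fun_ODE_recurrence(1)[OF gegenbauer_ODE[of x \<mu>]] assms
  by (simp add: gegenbauer_def)

lemma gegenbauer_recurrence:
  assumes "\<mu> \<noteq> 0"
  shows "real (n + 2) * gegenbauer \<mu> (n + 2) x
    = 2 * x * (real (n + 1) + \<mu>) * gegenbauer \<mu> (n + 1) x
      - (real n + 2 * \<mu>) * gegenbauer \<mu> n x"
  using gen_fun_ODE_recurrence(2)[OF gegenbauer_ODE[of x \<mu>], of n] assms
  by (simp add: gegenbauer_def)

text \<open>The three-term recurrence at \<open>1\<close> follows from the two-term recurrence of the right-hand side.\<close>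
lemma gegenbauer_at_1:
  assumes "\<mu> > 0"
  shows "gegenbauer \<mu> n 1 = pochhammer (2 * \<mu>) n / fact n"
proof -
  define b where "b m = pochhammer (2 * \<mu>) m / fact m" for m
  have b_Suc: "(real m + 1) * b (Suc m) = (2 * \<mu> + m) * b m" for m
    by (simp add: b_def pochhammer_Suc divide_simps)
  have "gegenbauer \<mu> n 1 = b n"
  proof (induction n rule: induct_nat_012)
    case 0
    show ?case by (simp add: gegenbauer_degree_0 b_def)
  next
    case 1
    show ?case using gegenbauer_degree_1[of \<mu> 1] assms by (simp add: b_def)
  next
    case (ge2 n)
    have "(real n + 2) * gegenbauer \<mu> (n + 2) 1
        = 2 * (real n + 1 + \<mu>) * b (Suc n) - (real n + 2 * \<mu>) * b n"
      using gegenbauer_recurrence[of \<mu> n 1] ge2 assms by (simp add: add.commute)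
    also have "\<dots> = (real n + 2) * b (Suc (Suc n))"
      using b_Suc[of n] b_Suc[of "Suc n"] by (simp add: algebra_simps)
    finally show ?case by simp
  qed
  thus ?thesis by (simp add: b_def)
qed

text \<open>
  With \<open>z = exp (i\<theta>)\<close>, this is the coefficient of \<open>s\<^sup>n\<close> in the factorization
  \<open>(1 - 2 s cos \<theta> + s\<^sup>2) powr -\<mu> = (1 - z s) powr -\<mu> * (1 - s / z) powr -\<mu>\<close>.
  The coefficients of the cosines are nonnegative for \<open>\<mu> > 0\<close>, so
  \<open>\<bar>C\<^sub>n\<^sup>\<mu> (cos \<theta>)\<bar>\<close> is largest at \<open>\<theta> = 0\<close>.
\<close>
lemma gegenbauer_cos_sum:
  assumes "\<mu> > 0"
  shows "gegenbauer \<mu> n (cos \<theta>) =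
    (\<Sum>k\<le>n. (pochhammer \<mu> k / fact k) * (pochhammer \<mu> (n - k) / fact (n - k))
       * cos ((real n - 2 * real k) * \<theta>))"
proof -
  define a :: "nat \<Rightarrow> real" where "a k = pochhammer \<mu> k / fact k" for k
  have a_Suc: "(real k + 1) * a (Suc k) = (\<mu> + k) * a k" for k
    by (simp add: a_def pochhammer_Suc divide_simps)
  \<comment> \<open>\<open>A z\<close> is the binomial series of \<open>(1 - z s) powr -\<mu>\<close>.\<close>
  define A where "A z = Abs_fps (\<lambda>k. of_real (a k) * z ^ k)" for z :: complex
  have A: "(1 - fps_const z * fps_X) * fps_deriv (A z) = fps_const (of_real \<mu> * z) * A z" for z
  proof (rule fps_ext)
    fix k
    have "fps_nth ((1 - fps_const z * fps_X) * fps_deriv (A z)) k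
        = fps_nth (fps_deriv (A z)) k - z * fps_nth (fps_X * fps_deriv (A z)) k"
      by (simp add: algebra_simps)
    also have "\<dots> = of_real ((real k + 1) * a (Suc k)) * z ^ Suc k - of_nat k * of_real (a k) * z ^ Suc k"
      by (cases k) (simp_all add: A_def algebra_simps)
    also have "\<dots> = fps_nth (fps_const (of_real \<mu> * z) * A z) k"
      unfolding a_Suc by (simp add: A_def algebra_simps)
    finally show "fps_nth ((1 - fps_const z * fps_X) * fps_deriv (A z)) k
        = fps_nth (fps_const (of_real \<mu> * z) * A z) k" .
  qed
  define z where "z = cis \<theta>"
  define w where "w = cis (-\<theta>)"
  have zw: "z * w = 1" by (simp add: z_def w_def cis_mult)
  have zpw: "z + w = of_real (2 * cos \<theta>)"
    by (simp add: z_def w_def complex_eq_iff)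
  define H where "H = A z * A w"
  have P: "(1 - fps_const z * fps_X) * (1 - fps_const w * fps_X)
      = 1 - fps_const (z + w) * fps_X + fps_X ^ 2"
  proof -
    have "(1 - fps_const z * fps_X) * (1 - fps_const w * fps_X)
      = 1 - (fps_const z + fps_const w) * fps_X + (fps_const z * fps_const w) * fps_X ^ 2"
      by (simp add: algebra_simps power2_eq_square del: fps_const_mult fps_const_add)
    thus ?thesis by (simp add: zw)
  qed
  have "(1 - fps_const (z + w) * fps_X + fps_X ^ 2) * fps_deriv H
      = ((1 - fps_const z * fps_X) * fps_deriv (A z)) * (1 - fps_const w * fps_X) * A w
        + ((1 - fps_const w * fps_X) * fps_deriv (A w)) * (1 - fps_const z * fps_X) * A z"
    unfolding P[symmetric] by (simp add: H_def algebra_simps del: fps_const_mult fps_const_add)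
  also have "\<dots> = fps_const (of_real \<mu>) * (fps_const z + fps_const w
        - 2 * (fps_const z * fps_const w) * fps_X) * H"
    unfolding A fps_const_mult[symmetric] by (simp add: H_def algebra_simps del: fps_const_mult fps_const_add)
  finally have "(1 - fps_const (z + w) * fps_X + fps_X ^ 2) * fps_deriv H
      = fps_const (of_real \<mu>) * (fps_const (z + w) - 2 * fps_X) * H"
    by (simp add: zw)
  note rec = gen_fun_ODE_recurrence[OF this, unfolded zpw]
  have H0: "fps_nth H 0 = 1"
    by (simp add: H_def A_def a_def)
  have eq: "fps_nth H n = of_real (gegenbauer \<mu> n (cos \<theta>))"
  proof (induction n rule: induct_nat_012)
    case 0
    show ?case by (simp add: H0 gegenbauer_degree_0)
  next
    case 1
    show ?case using rec(1) gegenbauer_degree_1[of \<mu> "cos \<theta>"] assms by (simp add: H0)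
  next
    case (ge2 n)
    have "of_nat (n + 2) * fps_nth H (n + 2) = of_real (real (n + 2) * gegenbauer \<mu> (n + 2) (cos \<theta>))"
      using assms ge2 by (subst rec(2), subst gegenbauer_recurrence) simp_all
    hence "of_nat (n + 2) * fps_nth H (n + 2) = of_nat (n + 2) * of_real (gegenbauer \<mu> (n + 2) (cos \<theta>))"
      by (simp only: of_real_mult of_real_of_nat_eq)
    hence "fps_nth H (n + 2) = of_real (gegenbauer \<mu> (n + 2) (cos \<theta>))"
      by (subst (asm) mult_cancel_left) (simp only: of_nat_eq_0_iff, simp)
    thus ?case by simp
  qed
  have "gegenbauer \<mu> n (cos \<theta>) = Re (fps_nth H n)"
    by (simp add: eq)
  also have "fps_nth H n = (\<Sum>k\<le>n. of_real (a k * a (n - k)) * cis (- ((real n - 2 * real k) * \<theta>)))"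
    unfolding H_def fps_mult_nth atLeast0AtMost
  proof (rule sum.cong)
    fix k assume "k \<in> {..n}"
    hence k: "real k * \<theta> + real (n - k) * - \<theta> = - ((real n - 2 * real k) * \<theta>)"
      by (simp add: of_nat_diff algebra_simps)
    have "z ^ k * w ^ (n - k) = cis (real k * \<theta> + real (n - k) * - \<theta>)"
      by (simp only: z_def w_def Complex.DeMoivre cis_mult)
    also note k
    finally have "z ^ k * w ^ (n - k) = cis (- ((real n - 2 * real k) * \<theta>))" .
    moreover have "fps_nth (A z) k * fps_nth (A w) (n - k)
        = of_real (a k * a (n - k)) * (z ^ k * w ^ (n - k))"
      by (simp add: A_def)
    ultimately show "fps_nth (A z) k * fps_nth (A w) (n - k)
        = of_real (a k * a (n - k)) * cis (- ((real n - 2 * real k) * \<theta>))"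
      by (simp only:)
  qed simp
  finally show ?thesis
    by (simp add: a_def del: of_real_mult)
qed

text \<open>\<open>C\<^sub>n\<^sup>1\<close> is the Chebyshev polynomial of the second kind.\<close>
lemma sin_times_gegenbauer_1:
  "sin \<theta> * gegenbauer 1 n (cos \<theta>) = sin (real (n + 1) * \<theta>)"
proof (induction n rule: induct_nat_012)
  case 0
  show ?case by (simp add: gegenbauer_degree_0)
next
  case 1
  show ?case using gegenbauer_degree_1[of 1 "cos \<theta>"] by (simp add: sin_double)
next
  case (ge2 n)
  have "(real n + 2) * gegenbauer 1 (n + 2) (cos \<theta>)
      = (real n + 2) * (2 * cos \<theta> * gegenbauer 1 (Suc n) (cos \<theta>) - gegenbauer 1 n (cos \<theta>))"
    using gegenbauer_recurrence[of 1 n "cos \<theta>"] by (simp add: algebra_simps)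
  hence "gegenbauer 1 (n + 2) (cos \<theta>)
      = 2 * cos \<theta> * gegenbauer 1 (Suc n) (cos \<theta>) - gegenbauer 1 n (cos \<theta>)"
    by (subst (asm) mult_cancel_left) auto
  hence "sin \<theta> * gegenbauer 1 (n + 2) (cos \<theta>)
      = 2 * cos \<theta> * sin (real (Suc n + 1) * \<theta>) - sin (real (n + 1) * \<theta>)"
    unfolding ge2[symmetric] by (simp only: right_diff_distrib mult_ac)
  also have "\<dots> = sin (real (Suc n + 1) * \<theta> + \<theta>)"
  proof -
    have "sin (real (n + 1) * \<theta>) = sin (real (Suc n + 1) * \<theta> - \<theta>)"
      by (simp add: algebra_simps)
    thus ?thesis by (simp only: sin_add sin_diff mult_ac)
  qed
  finally show ?case by (simp add: algebra_simps)
qed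

section \<open>Bounds on the interval \<open>[-1,1]\<close>\<close>

lemma gegenbauer_at_1_nonneg:
  assumes "\<mu> \<ge> 0"
  shows "0 \<le> gegenbauer \<mu> n 1"
proof (cases "\<mu> = 0")
  case True
  thus ?thesis by (simp add: gegenbauer_def)
next
  case False
  thus ?thesis using assms by (simp add: gegenbauer_at_1 pochhammer_nonneg)
qed

lemma abs_gegenbauer_le:
  assumes "\<mu> \<ge> 0" "x \<in> {-1..1}"
  shows "\<bar>gegenbauer \<mu> n x\<bar> \<le> gegenbauer \<mu> n 1"
proof (cases "\<mu> = 0")
  case True
  thus ?thesis by (auto simp: gegenbauer_def abs_mult divide_simps)
next
  case False
  hence \<mu>: "\<mu> > 0" using assms by simp
  define p where "p k = pochhammer \<mu> k / fact k * (pochhammer \<mu> (n - k) / fact (n - k))" for k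
  have p: "p k \<ge> 0" for k
    using \<mu> by (simp add: p_def pochhammer_nonneg)
  have sum: "gegenbauer \<mu> n (cos \<theta>) = (\<Sum>k\<le>n. p k * cos ((real n - 2 * real k) * \<theta>))" for \<theta>
    unfolding p_def by (rule gegenbauer_cos_sum[OF \<mu>])
  have "\<bar>gegenbauer \<mu> n (cos (arccos x))\<bar> \<le> (\<Sum>k\<le>n. \<bar>p k * cos ((real n - 2 * real k) * arccos x)\<bar>)"
    unfolding sum by (rule sum_abs)
  also have "\<dots> \<le> (\<Sum>k\<le>n. p k * cos ((real n - 2 * real k) * 0))"
    using p by (intro sum_mono) (simp add: abs_mult mult_left_le)
  also have "\<dots> = gegenbauer \<mu> n (cos 0)"
    unfolding sum ..
  finally show ?thesis using assms by simp
qed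

lemma gegenbauer_minus:
  assumes "x \<in> {-1..1}"
  shows "gegenbauer \<mu> n (-x) = (-1) ^ n * gegenbauer \<mu> n x"
proof (cases "\<mu> = 0")
  case True
  have "cos (real n * arccos (-x)) = cos (real n * pi - real n * arccos x)"
    using assms by (simp add: arccos_minus algebra_simps)
  also have "\<dots> = (-1) ^ n * cos (real n * arccos x)"
    by (simp add: cos_diff)
  finally show ?thesis using True by (simp add: gegenbauer_def)
next
  case False
  show ?thesis
  proof (induction n rule: induct_nat_012)
    case 0
    show ?case by (simp add: gegenbauer_degree_0)
  next
    case 1
    show ?case using gegenbauer_degree_1[OF False] by simp
  next
    case (ge2 n)
    have "real (n + 2) * gegenbauer \<mu> (n + 2) (-x)
        = real (n + 2) * ((-1) ^ n * gegenbauer \<mu> (n + 2) x)"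
      unfolding gegenbauer_recurrence[OF False] mult.left_commute[of "real (n + 2)"]
      using ge2 by (simp add: algebra_simps)
    thus ?case by (subst (asm) mult_cancel_left) (simp del: of_nat_add)
  qed
qed

lemma pochhammer_mono:
  fixes a b :: real
  assumes "0 \<le> a" "a \<le> b"
  shows "pochhammer a n \<le> pochhammer b n"
  unfolding pochhammer_prod using assms by (intro prod_mono) auto

lemma delta_pos: "\<nu> \<ge> 0 \<Longrightarrow> delta \<nu> > 0"
  by (simp add: delta_def)

text \<open>
  Lowering the order by one while raising the degree by one multiplies the value at \<open>1\<close> by at most
  \<open>delta \<nu>\<close>, the factor by which integration of \<open>C\<^sub>n\<^sup>\<nu>\<^sup>+\<^sup>1\<close> divides. Hence absolute convergence survives
  every integration.
\<close>
lemma gegenbauer_at_1_Suc_le: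
  assumes "\<nu> \<ge> 0"
  shows "gegenbauer \<nu> (Suc n) 1 \<le> delta \<nu> * gegenbauer (\<nu> + 1) n 1"
proof (cases "\<nu> = 0")
  case True
  have "fact n \<le> (pochhammer 2 n :: real)"
    using pochhammer_mono[of 1 2 n] by (simp add: pochhammer_fact)
  hence "1 \<le> gegenbauer 1 n 1"
    by (simp add: gegenbauer_at_1)
  moreover have "gegenbauer 0 (Suc n) 1 \<le> 2"
    by (simp add: gegenbauer_def divide_simps)
  ultimately show ?thesis
    by (simp add: True delta_def)
next
  case False
  hence \<nu>: "\<nu> > 0" using assms by simp
  have "gegenbauer \<nu> (Suc n) 1 = 2 * \<nu> * pochhammer (2 * \<nu> + 1) n / fact (Suc n)"
    using \<nu> by (simp only: gegenbauer_at_1 pochhammer_rec)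
  also have "\<dots> \<le> 2 * \<nu> * pochhammer (2 * (\<nu> + 1)) n / fact n"
    using \<nu> by (intro frac_le mult_left_mono pochhammer_mono fact_mono) (auto simp: pochhammer_nonneg)
  also have "\<dots> = delta \<nu> * gegenbauer (\<nu> + 1) n 1"
    using \<nu> by (simp add: gegenbauer_at_1 delta_def)
  finally show ?thesis .
qed

section \<open>Differentiation and integration of Gegenbauer series\<close>

lemma fps_nth_mult_has_derivative:
  fixes F G :: "real \<Rightarrow> real fps"
  assumes "\<And>n. ((\<lambda>x. fps_nth (F x) n) has_field_derivative fps_nth F' n) (at x)"
    and "\<And>n. ((\<lambda>x. fps_nth (G x) n) has_field_derivative fps_nth G' n) (at x)"
  shows "((\<lambda>x. fps_nth (F x * G x) n) has_field_derivative fps_nth (F' * G x + F x * G') n) (at x)"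
  unfolding fps_mult_nth fps_add_nth sum.distrib[symmetric]
  by (rule DERIV_sum) (rule derivative_eq_intros assms refl | simp)+

lemma fps_nth_power_has_derivative:
  fixes F :: "real \<Rightarrow> real fps"
  assumes "\<And>n. ((\<lambda>x. fps_nth (F x) n) has_field_derivative fps_nth F' n) (at x)"
  shows "((\<lambda>x. fps_nth (F x ^ j) n) has_field_derivative
           fps_nth (of_nat j * F x ^ (j - 1) * F') n) (at x)"
proof (induction j arbitrary: n)
  case 0
  show ?case by simp
next
  case (Suc j)
  have "of_nat j * F x ^ (j - 1) * F' * F x + F x ^ j * F' = of_nat (Suc j) * F x ^ j * F'"
    by (cases j) (simp_all add: algebra_simps)
  thus ?case
    using fps_nth_mult_has_derivative[OF Suc.IH assms, of n] by (simp add: mult.commute)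
qed

text \<open>
  The \<open>n\<close>-th coefficient of the composed binomial series is a finite combination of the coefficients of
  the powers of \<open>s\<^sup>2 - 2 x s\<close>, and the derivative of such a power in \<open>x\<close> is \<open>-2 s j\<close> times the previous
  power.
\<close>
lemma gegenbauer_pos_order_has_derivative:
  assumes "\<nu> > 0"
  shows "(gegenbauer \<nu> (Suc n) has_field_derivative 2 * \<nu> * gegenbauer (\<nu> + 1) n x) (at x)"
proof -
  define h :: "real \<Rightarrow> real fps" where "h x = fps_X ^ 2 - fps_const (2 * x) * fps_X" for x
  have g: "gegenbauer \<mu> m y = (\<Sum>j\<le>m. ((-\<mu>) gchoose j) * fps_nth (h y ^ j) m)"
    if "\<mu> > 0" for \<mu> m y
    using that by (simp add: gegenbauer_def fps_compose_nth h_def atLeast0AtMost)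
  have h': "((\<lambda>x. fps_nth (h x) m) has_field_derivative fps_nth (fps_const (-2) * fps_X) m) (at x)" for m
    by (cases "m = 1") (auto simp: h_def intro!: derivative_eq_intros)
  have "(gegenbauer \<nu> (Suc n) has_field_derivative
      (\<Sum>j\<le>Suc n. ((-\<nu>) gchoose j) * fps_nth (of_nat j * h x ^ (j - 1) * (fps_const (-2) * fps_X)) (Suc n))) (at x)"
    unfolding g[OF assms, abs_def]
    by (intro DERIV_sum DERIV_cmult fps_nth_power_has_derivative h')
  also have "(\<Sum>j\<le>Suc n. ((-\<nu>) gchoose j) * fps_nth (of_nat j * h x ^ (j - 1) * (fps_const (-2) * fps_X)) (Suc n))
      = (\<Sum>j\<le>n. -2 * (of_nat (Suc j) * ((-\<nu>) gchoose Suc j)) * fps_nth (h x ^ j) n)"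
  proof -
    have "fps_nth (of_nat (Suc j) * h x ^ j * (fps_const (-2) * fps_X)) (Suc n)
        = -2 * real (Suc j) * fps_nth (h x ^ j) n" for j
    proof -
      have "of_nat (Suc j) * h x ^ j * (fps_const (-2) * fps_X)
          = fps_const (-2) * (fps_const (real (Suc j)) * (fps_X * h x ^ j))"
        unfolding fps_of_nat by (simp only: mult_ac)
      thus ?thesis by (simp only: fps_mult_left_const_nth fps_X_mult_nth) (simp add: algebra_simps)
    qed
    thus ?thesis by (subst sum.atMost_Suc_shift) (simp del: of_nat_Suc, simp add: algebra_simps)
  qed
  also have "\<dots> = 2 * \<nu> * gegenbauer (\<nu> + 1) n x"
    unfolding gbinomial_absorption using assms
    by (simp add: g sum_distrib_left mult.assoc)
  finally show ?thesis .
qed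

text \<open>
  At order \<open>0\<close> the endpoints are excluded, because \<open>arccos\<close> is not differentiable there.
\<close>
lemma gegenbauer_order_0_has_derivative:
  assumes "x \<in> {-1<..<1}"
  shows "(gegenbauer 0 (Suc n) has_field_derivative 2 * gegenbauer 1 n x) (at x)"
proof -
  have s: "sin (arccos x) = sqrt (1 - x\<^sup>2)" "sqrt (1 - x\<^sup>2) \<noteq> 0"
    using assms sin_arccos_nonzero[of x] by (auto simp: sin_arccos)
  have "gegenbauer 1 n x = sin (real (n + 1) * arccos x) / sqrt (1 - x\<^sup>2)"
    using sin_times_gegenbauer_1[of "arccos x" n] assms s by (simp add: field_simps)
  hence eq: "2 / real (n + 1) * (- sin (real (n + 1) * arccos x) * (real (n + 1) * inverse (- sqrt (1 - x\<^sup>2))))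
      = 2 * gegenbauer 1 n x"
    by (simp add: divide_inverse del: of_nat_add)
  have "gegenbauer 0 (Suc n) = (\<lambda>x. 2 / real (n + 1) * cos (real (n + 1) * arccos x))"
    by (simp add: gegenbauer_def fun_eq_iff)
  moreover have "((\<lambda>x. 2 / real (n + 1) * cos (real (n + 1) * arccos x)) has_field_derivative
      2 / real (n + 1) * (- sin (real (n + 1) * arccos x) * (real (n + 1) * inverse (- sqrt (1 - x\<^sup>2)))))
      (at x)"
    using assms by (intro DERIV_cmult DERIV_fun_cos DERIV_arccos) auto
  ultimately show ?thesis
    unfolding eq by simp
qed

lemma gegenbauer_Suc_has_derivative:
  assumes "\<nu> \<ge> 0" "x \<in> {-1<..<1}"
  shows "(gegenbauer \<nu> (Suc n) has_field_derivative delta \<nu> * gegenbauer (\<nu> + 1) n x) (at x)"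
  using gegenbauer_pos_order_has_derivative[of \<nu> n x] gegenbauer_order_0_has_derivative[of x n] assms
  by (cases "\<nu> = 0") (auto simp: delta_def)

lemma continuous_on_gegenbauer:
  assumes "\<nu> \<ge> 0"
  shows "continuous_on {-1..1} (gegenbauer \<nu> n)"
proof (cases n)
  case 0
  thus ?thesis by (simp add: gegenbauer_degree_0[abs_def])
next
  case n: (Suc m)
  show ?thesis
  proof (cases "\<nu> = 0")
    case True
    have "continuous_on {-1..1} (\<lambda>x::real. 2 / real n * cos (real n * arccos x))"
      by (intro continuous_intros) auto
    thus ?thesis
      using True n by (simp add: gegenbauer_def[abs_def])
  next
    case False
    thus ?thesis
      unfolding n using assms
      by (intro DERIV_continuous_on[OF has_field_derivative_at_within[OF gegenbauer_pos_order_has_derivative]]) simp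
  qed
qed

text \<open>The antiderivative vanishes at \<open>-1\<close>, where \<open>C\<^sub>n\<^sub>+\<^sub>1\<close> equals \<open>(-1) ^ (n + 1)\<close> times its value at \<open>1\<close>.\<close>
lemma gegenbauer_has_integral:
  assumes "\<nu> \<ge> 0" "x \<in> {-1..1}"
  shows "(gegenbauer (\<nu> + 1) n has_integral
    (gegenbauer \<nu> (Suc n) x + (-1) ^ n * gegenbauer \<nu> (Suc n) 1) / delta \<nu>) {-1..x}"
proof -
  have "((\<lambda>u. delta \<nu> * gegenbauer (\<nu> + 1) n u) has_integral
      gegenbauer \<nu> (Suc n) x - gegenbauer \<nu> (Suc n) (-1)) {-1..x}"
    using assms gegenbauer_Suc_has_derivative[of \<nu> _ n]
    by (intro fundamental_theorem_of_calculus_interior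
        continuous_on_subset[OF continuous_on_gegenbauer])
      (auto simp: has_real_derivative_iff_has_vector_derivative)
  from has_integral_mult_right[OF this, of "1 / delta \<nu>"] show ?thesis
    using gegenbauer_minus[of 1 \<nu> "Suc n"] delta_pos[OF assms(1)]
    by simp
qed

lemma gegenbauer_series_integral:
  assumes \<nu>: "\<nu> \<ge> 0" and x: "x \<in> {-1..1}"
    and c: "summable (\<lambda>n. \<bar>c n\<bar> * gegenbauer (\<nu> + 1) n 1)"
    and g: "\<And>u. u \<in> {-1..1} \<Longrightarrow> (\<lambda>n. c n * gegenbauer (\<nu> + 1) n u) sums g u"
  shows "(\<lambda>n. c n / delta \<nu> * (gegenbauer \<nu> (Suc n) x + (-1) ^ n * gegenbauer \<nu> (Suc n) 1))
    sums integral {-1..x} g"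
proof -
  have \<nu>1: "\<nu> + 1 \<ge> 0" using \<nu> by simp
  have "uniform_limit {-1..x} (\<lambda>N u. \<Sum>n<N. c n * gegenbauer (\<nu> + 1) n u)
      (\<lambda>u. \<Sum>n. c n * gegenbauer (\<nu> + 1) n u) sequentially"
    using x by (intro Weierstrass_m_test[OF _ c])
      (auto simp: abs_mult intro!: mult_left_mono abs_gegenbauer_le \<nu>1)
  also have "?this \<longleftrightarrow> uniform_limit {-1..x} (\<lambda>N u. \<Sum>n<N. c n * gegenbauer (\<nu> + 1) n u) g sequentially"
    using x g by (intro uniform_limit_cong') (auto simp: sums_iff)
  finally have "uniform_limit {-1..x} (\<lambda>N u. \<Sum>n<N. c n * gegenbauer (\<nu> + 1) n u) g sequentially" .
  then obtain I J where IJ: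
    "\<And>N. ((\<lambda>u. \<Sum>n<N. c n * gegenbauer (\<nu> + 1) n u) has_integral I N) {-1..x}"
    "(g has_integral J) {-1..x}" "I \<longlonglongrightarrow> J"
    by (rule uniform_limit_integral)
      (use x in \<open>auto intro!: continuous_intros continuous_on_subset[OF continuous_on_gegenbauer[OF \<nu>1]]\<close>)
  have "((\<lambda>u. \<Sum>n<N. c n * gegenbauer (\<nu> + 1) n u) has_integral
      (\<Sum>n<N. c n * ((gegenbauer \<nu> (Suc n) x + (-1) ^ n * gegenbauer \<nu> (Suc n) 1) / delta \<nu>))) {-1..x}" for N
    by (intro has_integral_sum has_integral_mult_right gegenbauer_has_integral \<nu> x) simp
  hence "I N = (\<Sum>n<N. c n * ((gegenbauer \<nu> (Suc n) x + (-1) ^ n * gegenbauer \<nu> (Suc n) 1) / delta \<nu>))" for N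
    using IJ(1) has_integral_unique by blast
  hence "I = (\<lambda>N. \<Sum>n<N. c n / delta \<nu> * (gegenbauer \<nu> (Suc n) x + (-1) ^ n * gegenbauer \<nu> (Suc n) 1))"
    by (simp add: fun_eq_iff)
  thus ?thesis
    using IJ(2,3) by (simp add: sums_def integral_unique)
qed

section \<open>Schoenberg functions\<close>

text \<open>Two points at distance \<open>t\<close> with weights \<open>1, 1\<close> and \<open>1, -1\<close> give \<open>f 0 + f t \<ge> 0\<close> and \<open>f 0 - f t \<ge> 0\<close>.\<close>
lemma pd_euclidean_abs_le:
  assumes "f \<in> pd_euclidean TYPE('k::finite)" "t \<ge> 0"
  shows "\<bar>f t\<bar> \<le> f 0"
proof -
  define y :: "real ^ 'k" where "y = t *\<^sub>R axis undefined 1"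
  have y: "norm y = t" using assms(2) by (simp add: y_def)
  have pd: "0 \<le> (\<Sum>i<2. \<Sum>j<2. a i * f (norm (z i - z j)) * a j)"
    for a :: "nat \<Rightarrow> real" and z :: "nat \<Rightarrow> real ^ 'k"
    using assms(1) by (auto simp: pd_euclidean_def positive_definite_on_def)
  define z where "z i = (if i = 0 then y else 0)" for i :: nat
  have "0 \<le> 2 * f 0 + 2 * f t"
    using pd[of "\<lambda>_. 1" z] y by (simp add: z_def numeral_2_eq_2)
  moreover have "0 \<le> 2 * f 0 - 2 * f t"
    using pd[of "\<lambda>i. if i = 0 then 1 else -1" z] y by (simp add: z_def numeral_2_eq_2)
  ultimately show ?thesis by linarith
qed

section \<open>The coefficients of the iterated integral\<close>

text \<open>The order of the Gegenbauer polynomials after \<open>\<kappa>\<close> integrations, starting from \<open>(d - 1) / 2\<close>.\<close>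
abbreviation lowered_order :: "nat \<Rightarrow> nat \<Rightarrow> real" where
  "lowered_order d \<kappa> \<equiv> (real d - 2 * real \<kappa> - 1) / 2"

lemma lowered_order_Suc: "lowered_order d \<kappa> = lowered_order d (Suc \<kappa>) + 1"
  by (simp add: field_simps)

lemma tau_Suc: "tau d (Suc \<kappa>) = tau d \<kappa> / delta (lowered_order d (Suc \<kappa>))"
proof -
  have "inverse (\<Prod>j=1..Suc \<kappa>. D j) = inverse (\<Prod>j=1..\<kappa>. D j) / D (Suc \<kappa>)" for D :: "nat \<Rightarrow> real"
    by (simp add: divide_inverse)
  thus ?thesis
    unfolding tau_def .
qed

lemma tau_pos:
  assumes "2 * \<kappa> < d"
  shows "tau d \<kappa> > 0"
  unfolding tau_def using assms
  by (intro positive_imp_inverse_positive prod_pos) (auto intro!: delta_pos)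

lemma gegenbauer_at_1_shift_le:
  assumes "2 * \<kappa> < d"
  shows "\<exists>K>0. \<forall>i. gegenbauer (lowered_order d \<kappa>) (i + \<kappa>) 1 \<le> K * gegenbauer ((real d - 1) / 2) i 1"
  using assms
proof (induction \<kappa>)
  case 0
  show ?case by (intro exI[of _ 1]) simp
next
  case (Suc \<kappa>)
  then obtain K where K: "K > 0"
    "\<And>i. gegenbauer (lowered_order d \<kappa>) (i + \<kappa>) 1 \<le> K * gegenbauer ((real d - 1) / 2) i 1"
    by auto
  have \<nu>: "lowered_order d (Suc \<kappa>) \<ge> 0" using Suc.prems by simp
  let ?\<delta> = "delta (lowered_order d (Suc \<kappa>))"
  have "gegenbauer (lowered_order d (Suc \<kappa>)) (i + Suc \<kappa>) 1 \<le> (?\<delta> * K) * gegenbauer ((real d - 1) / 2) i 1" for i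
  proof -
    have "gegenbauer (lowered_order d (Suc \<kappa>)) (Suc (i + \<kappa>)) 1 \<le> ?\<delta> * gegenbauer (lowered_order d \<kappa>) (i + \<kappa>) 1"
      unfolding lowered_order_Suc[of d \<kappa>] by (rule gegenbauer_at_1_Suc_le[OF \<nu>])
    also have "\<dots> \<le> ?\<delta> * (K * gegenbauer ((real d - 1) / 2) i 1)"
      using delta_pos[OF \<nu>] by (intro mult_left_mono K) auto
    finally show ?thesis by (simp add: mult.assoc)
  qed
  thus ?case using K(1) delta_pos[OF \<nu>] by (intro exI[of _ "?\<delta> * K"]) auto
qed

lemma chi_bound:
  assumes "2 * \<kappa> < d" "n < \<kappa>"
  shows "\<exists>\<Upsilon>>0. \<forall>i. \<bar>chi d \<kappa> n i\<bar> \<le> \<Upsilon> * gegenbauer ((real d - 1) / 2) i 1"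
  using assms
proof (induction \<kappa> arbitrary: n)
  case 0
  thus ?case by simp
next
  case (Suc \<kappa>)
  let ?B = "\<lambda>i. gegenbauer ((real d - 1) / 2) i 1"
  let ?C = "\<lambda>i. gegenbauer (lowered_order d (Suc \<kappa>)) i 1"
  have \<nu>: "lowered_order d (Suc \<kappa>) \<ge> 0" using Suc.prems(1) by simp
  show ?case
  proof (cases n)
    case (Suc m)
    thus ?thesis using Suc.prems Suc.IH[of m] by simp
  next
    case 0
    have "\<exists>\<Upsilon>. m < \<kappa> \<longrightarrow> \<Upsilon> > 0 \<and> (\<forall>i. \<bar>chi d \<kappa> m i\<bar> \<le> \<Upsilon> * ?B i)" for m
      using Suc.IH[of m] Suc.prems(1) by (cases "m < \<kappa>") auto
    then obtain \<Upsilon> where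
      "\<forall>m. m < \<kappa> \<longrightarrow> \<Upsilon> m > 0 \<and> (\<forall>i. \<bar>chi d \<kappa> m i\<bar> \<le> \<Upsilon> m * ?B i)"
      using choice[of "\<lambda>m \<Upsilon>. m < \<kappa> \<longrightarrow> \<Upsilon> > 0 \<and> (\<forall>i. \<bar>chi d \<kappa> m i\<bar> \<le> \<Upsilon> * ?B i)"] by blast
    hence \<Upsilon>: "\<And>m. m < \<kappa> \<Longrightarrow> \<Upsilon> m > 0"
      "\<And>m i. m < \<kappa> \<Longrightarrow> \<bar>chi d \<kappa> m i\<bar> \<le> \<Upsilon> m * ?B i"
      by auto
    obtain K where K: "K > 0" "\<And>i. ?C (i + Suc \<kappa>) \<le> K * ?B i"
      using gegenbauer_at_1_shift_le[OF Suc.prems(1)] by auto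
    define Y where "Y = (\<Sum>j=1..\<kappa>. \<Upsilon> (j - 1) * ?C j) + K"
    have "\<bar>chi d (Suc \<kappa>) 0 i\<bar> \<le> Y * ?B i" for i
    proof -
      have "\<bar>chi d (Suc \<kappa>) 0 i\<bar> \<le>
          \<bar>\<Sum>j=1..\<kappa>. (-1) ^ (j + 1) * chi d \<kappa> (j - 1) i * ?C j\<bar> + \<bar>(-1) ^ Suc \<kappa> * ?C (i + Suc \<kappa>)\<bar>"
        unfolding chi.simps by (rule abs_triangle_ineq4)
      also have "\<dots> \<le> (\<Sum>j=1..\<kappa>. \<Upsilon> (j - 1) * ?B i * ?C j) + K * ?B i"
      proof (intro add_mono order_trans[OF sum_abs] sum_mono)
        fix j assume "j \<in> {1..\<kappa>}"
        hence "\<bar>chi d \<kappa> (j - 1) i\<bar> \<le> \<Upsilon> (j - 1) * ?B i"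
          by (intro \<Upsilon>(2)) auto
        from mult_right_mono[OF this gegenbauer_at_1_nonneg[OF \<nu>, of j]]
        show "\<bar>(-1) ^ (j + 1) * chi d \<kappa> (j - 1) i * ?C j\<bar> \<le> \<Upsilon> (j - 1) * ?B i * ?C j"
          using gegenbauer_at_1_nonneg[OF \<nu>, of j] by (simp add: abs_mult power_abs)
      next
        show "\<bar>(-1) ^ Suc \<kappa> * ?C (i + Suc \<kappa>)\<bar> \<le> K * ?B i"
          using K(2)[of i] gegenbauer_at_1_nonneg[OF \<nu>, of "i + Suc \<kappa>"]
          by (simp add: abs_mult power_abs)
      qed
      also have "\<dots> = Y * ?B i"
        by (simp only: Y_def distrib_right sum_distrib_right) (simp add: mult_ac)
      finally show ?thesis .
    qed
    moreover have "Y > 0"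
      unfolding Y_def using \<Upsilon>(1) K(1) \<nu>
      by (intro add_nonneg_pos sum_nonneg mult_nonneg_nonneg gegenbauer_at_1_nonneg) (auto intro: less_imp_le)
    ultimately show ?thesis using 0 by blast
  qed
qed

lemma chi_summable:
  assumes "2 * \<kappa> < d" "n < \<kappa>"
    and f: "summable (\<lambda>i. \<bar>f i\<bar> * gegenbauer ((real d - 1) / 2) i 1)"
  shows "summable (\<lambda>i. (-1) ^ i * chi d \<kappa> n i * f i)"
proof -
  obtain \<Upsilon> where \<Upsilon>: "\<Upsilon> > 0" "\<And>i. \<bar>chi d \<kappa> n i\<bar> \<le> \<Upsilon> * gegenbauer ((real d - 1) / 2) i 1"
    using chi_bound[OF assms(1,2)] by auto
  show ?thesis
  proof (rule summable_comparison_test'[OF summable_mult[OF f, of \<Upsilon>]])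
    fix i :: nat
    show "norm ((-1) ^ i * chi d \<kappa> n i * f i) \<le> \<Upsilon> * (\<bar>f i\<bar> * gegenbauer ((real d - 1) / 2) i 1)"
      using mult_right_mono[OF \<Upsilon>(2)[of i], of "\<bar>f i\<bar>"]
      by (simp add: abs_mult power_abs mult_ac)
  qed
qed

text \<open>
  Apart from the constant of integration, the \<open>(\<kappa> + 1)\<close>-st integration shifts the coefficients by one
  degree and divides them by \<open>delta\<close>.
\<close>
lemma tilde_f_Suc_Suc:
  "tilde_f d (Suc \<kappa>) f (Suc n) t = tilde_f d \<kappa> f n t / delta (lowered_order d (Suc \<kappa>))"
  by (simp add: tilde_f_def tau_Suc)

lemma tilde_f_summable:
  assumes "2 * \<kappa> < d" and f: "summable (\<lambda>i. \<bar>f i t\<bar> * gegenbauer ((real d - 1) / 2) i 1)"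
  shows "summable (\<lambda>n. \<bar>tilde_f d \<kappa> f n t\<bar> * gegenbauer (lowered_order d \<kappa>) n 1)"
  using assms(1)
proof (induction \<kappa>)
  case 0
  show ?case using f by (simp add: tilde_f_def tau_def)
next
  case (Suc \<kappa>)
  have \<nu>: "lowered_order d (Suc \<kappa>) \<ge> 0" using Suc.prems by simp
  let ?\<delta> = "delta (lowered_order d (Suc \<kappa>))"
  have "summable (\<lambda>n. \<bar>tilde_f d (Suc \<kappa>) f (Suc n) t\<bar> * gegenbauer (lowered_order d (Suc \<kappa>)) (Suc n) 1)"
  proof (rule summable_comparison_test')
    show "summable (\<lambda>n. \<bar>tilde_f d \<kappa> f n t\<bar> * gegenbauer (lowered_order d \<kappa>) n 1)"
      using Suc by simp
    fix n
    have "\<bar>tilde_f d \<kappa> f n t\<bar> / ?\<delta> * gegenbauer (lowered_order d (Suc \<kappa>)) (Suc n) 1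
        \<le> \<bar>tilde_f d \<kappa> f n t\<bar> / ?\<delta> * (?\<delta> * gegenbauer (lowered_order d \<kappa>) n 1)"
      unfolding lowered_order_Suc[of d \<kappa>] using delta_pos[OF \<nu>]
      by (intro mult_left_mono gegenbauer_at_1_Suc_le \<nu>) auto
    thus "norm (\<bar>tilde_f d (Suc \<kappa>) f (Suc n) t\<bar> * gegenbauer (lowered_order d (Suc \<kappa>)) (Suc n) 1)
        \<le> \<bar>tilde_f d \<kappa> f n t\<bar> * gegenbauer (lowered_order d \<kappa>) n 1"
      using delta_pos[OF \<nu>] gegenbauer_at_1_nonneg[OF \<nu>, of "Suc n"]
      by (simp add: tilde_f_Suc_Suc abs_mult)
  qed
  thus ?case by (rule summable_Suc_iff[THEN iffD1])
qed

text \<open>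
  The coefficient of degree \<open>0\<close> after the \<open>(\<kappa> + 1)\<close>-st integration collects the constants of integration
  of all terms. Terms of degree below \<open>\<kappa>\<close> are themselves series in \<open>f\<close>; interchanging the finite sum
  over them with those series produces the recursion for \<open>chi\<close>.
\<close>
lemma tilde_f_Suc_0:
  assumes d: "2 * Suc \<kappa> < d"
    and f: "summable (\<lambda>i. \<bar>f i t\<bar> * gegenbauer ((real d - 1) / 2) i 1)"
    and s: "summable (\<lambda>n. tilde_f d \<kappa> f n t * ((-1) ^ n * gegenbauer (lowered_order d (Suc \<kappa>)) (Suc n) 1))"
  shows "tilde_f d (Suc \<kappa>) f 0 t = (\<Sum>n. tilde_f d (Suc \<kappa>) f (Suc n) t *
      ((-1) ^ n * gegenbauer (lowered_order d (Suc \<kappa>)) (Suc n) 1))"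
proof -
  let ?C = "\<lambda>n. gegenbauer (lowered_order d (Suc \<kappa>)) n 1"
  let ?\<delta> = "delta (lowered_order d (Suc \<kappa>))"
  \<comment> \<open>Up to \<open>?\<delta>\<close>, \<open>g n\<close> is the constant contributed by degree \<open>n\<close>; it is \<open>tau d \<kappa>\<close> times the sum of the
      series \<open>a n\<close> if \<open>n < \<kappa>\<close>, and \<open>tau d \<kappa>\<close> times the single term \<open>b (n - \<kappa>)\<close> otherwise.\<close>
  define g where "g n = tilde_f d \<kappa> f n t * ((-1) ^ n * ?C (Suc n))" for n
  define a where "a n i = (-1) ^ i * chi d \<kappa> n i * f i t * ((-1) ^ n * ?C (Suc n))" for n i
  define b where "b i = f i t * ((-1) ^ (i + \<kappa>) * ?C (i + Suc \<kappa>))" for i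
  have g_shift: "g (i + \<kappa>) = tau d \<kappa> * b i" for i
    by (simp add: g_def b_def tilde_f_def)
  have "summable (\<lambda>i. tau d \<kappa> * b i)"
    using s unfolding g_def[symmetric] g_shift[symmetric] by (simp add: summable_iff_shift)
  hence b: "summable b"
    using tau_pos[of \<kappa> d] d by (simp add: summable_cmult_iff)
  have a: "summable (a n)" if "n < \<kappa>" for n
    unfolding a_def using d that by (intro summable_mult2 chi_summable f) auto
  have chi: "(-1) ^ i * chi d (Suc \<kappa>) 0 i * f i t = (\<Sum>n<\<kappa>. a n i) + b i" for i
  proof -
    have "(\<Sum>j=1..\<kappa>. (-1) ^ (j + 1) * chi d \<kappa> (j - 1) i * ?C j)
        = (\<Sum>n<\<kappa>. (-1) ^ n * chi d \<kappa> n i * ?C (Suc n))"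
      unfolding One_nat_def sum.atLeast1_atMost_eq by simp
    hence "chi d (Suc \<kappa>) 0 i = (\<Sum>n<\<kappa>. (-1) ^ n * chi d \<kappa> n i * ?C (Suc n))
        + (-1) ^ \<kappa> * ?C (i + Suc \<kappa>)"
      by simp
    thus ?thesis
      by (simp add: a_def b_def algebra_simps sum_distrib_left sum_distrib_right power_add)
  qed
  have g_less: "g n = tau d \<kappa> * (\<Sum>i. a n i)" if "n < \<kappa>" for n
  proof -
    have "summable (\<lambda>i. (-1) ^ i * chi d \<kappa> n i * f i t)"
      using that d by (intro chi_summable f) auto
    hence "(\<Sum>i. a n i) = (\<Sum>i. (-1) ^ i * chi d \<kappa> n i * f i t) * ((-1) ^ n * ?C (Suc n))"
      unfolding a_def by (rule suminf_mult2[symmetric])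
    thus ?thesis
      using that by (simp add: g_def tilde_f_def)
  qed
  have "(\<Sum>n. tilde_f d (Suc \<kappa>) f (Suc n) t * ((-1) ^ n * ?C (Suc n))) = (\<Sum>n. g n / ?\<delta>)"
    by (simp add: tilde_f_Suc_Suc g_def)
  also have "\<dots> = (\<Sum>n. g n) / ?\<delta>"
    using s unfolding g_def by (rule suminf_divide)
  also have "(\<Sum>n. g n) = (\<Sum>i. tau d \<kappa> * b i) + (\<Sum>n<\<kappa>. g n)"
    using suminf_split_initial_segment[of g \<kappa>] s unfolding g_def[symmetric] g_shift by simp
  also have "\<dots> = tau d \<kappa> * ((\<Sum>n<\<kappa>. \<Sum>i. a n i) + (\<Sum>i. b i))"
    by (simp add: suminf_mult[OF b] g_less sum_distrib_left distrib_left)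
  also have "(\<Sum>n<\<kappa>. \<Sum>i. a n i) = (\<Sum>i. \<Sum>n<\<kappa>. a n i)"
    using a by (intro suminf_sum[symmetric]) auto
  also have "\<dots> + (\<Sum>i. b i) = (\<Sum>i. (\<Sum>n<\<kappa>. a n i) + b i)"
    using a b by (intro suminf_add summable_sum) auto
  also have "\<dots> = (\<Sum>i. (-1) ^ i * chi d (Suc \<kappa>) 0 i * f i t)"
    by (simp only: chi)
  also have "tau d \<kappa> * \<dots> / ?\<delta> = tilde_f d (Suc \<kappa>) f 0 t"
    by (simp add: tilde_f_def tau_Suc)
  finally show ?thesis ..
qed

section \<open>The Gegenbauer series of the iterated integral\<close>

lemma iterated_integral_sums:
  assumes "2 * \<kappa> < d"
    and f: "summable (\<lambda>i. \<bar>f i t\<bar> * gegenbauer ((real d - 1) / 2) i 1)"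
    and \<phi>: "\<And>x. x \<in> {-1..1} \<Longrightarrow> (\<lambda>n. f n t * gegenbauer ((real d - 1) / 2) n x) sums \<phi> x t"
    and "x \<in> {-1..1}"
  shows "(\<lambda>n. tilde_f d \<kappa> f n t * gegenbauer (lowered_order d \<kappa>) n x) sums (I1 ^^ \<kappa>) \<phi> x t"
  using assms(1,4)
proof (induction \<kappa> arbitrary: x)
  case 0
  thus ?case using \<phi> by (simp add: tilde_f_def tau_def)
next
  case (Suc \<kappa>)
  let ?\<nu> = "lowered_order d (Suc \<kappa>)"
  have \<nu>: "?\<nu> \<ge> 0" using Suc.prems by simp
  let ?c = "\<lambda>n. tilde_f d (Suc \<kappa>) f (Suc n) t"
  have integral: "(\<lambda>n. ?c n * (gegenbauer ?\<nu> (Suc n) x + (-1) ^ n * gegenbauer ?\<nu> (Suc n) 1))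
      sums (I1 ^^ Suc \<kappa>) \<phi> x t" if x: "x \<in> {-1..1}" for x
  proof -
    have "summable (\<lambda>n. \<bar>tilde_f d \<kappa> f n t\<bar> * gegenbauer (?\<nu> + 1) n 1)"
      unfolding lowered_order_Suc[symmetric] using Suc.prems by (intro tilde_f_summable f) auto
    moreover have "(\<lambda>n. tilde_f d \<kappa> f n t * gegenbauer (?\<nu> + 1) n u) sums (I1 ^^ \<kappa>) \<phi> u t"
      if "u \<in> {-1..1}" for u
      unfolding lowered_order_Suc[symmetric] using Suc.prems that by (intro Suc.IH) auto
    ultimately have "(\<lambda>n. tilde_f d \<kappa> f n t / delta ?\<nu> *
        (gegenbauer ?\<nu> (Suc n) x + (-1) ^ n * gegenbauer ?\<nu> (Suc n) 1))
        sums integral {-1..x} (\<lambda>u. (I1 ^^ \<kappa>) \<phi> u t)"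
      by (rule gegenbauer_series_integral[OF \<nu> x])
    thus ?thesis
      by (simp only: tilde_f_Suc_Suc funpow.simps comp_def I1_def)
  qed
  have M: "summable (\<lambda>n. \<bar>?c n\<bar> * gegenbauer ?\<nu> (Suc n) 1)"
    using tilde_f_summable[where f = f and t = t, OF Suc.prems(1) f] by (subst summable_Suc_iff)
  have const: "summable (\<lambda>n. ?c n * ((-1) ^ n * gegenbauer ?\<nu> (Suc n) 1))"
    using gegenbauer_at_1_nonneg[OF \<nu>]
    by (intro summable_comparison_test'[OF M]) (simp add: abs_mult power_abs)
  hence "summable (\<lambda>n. tilde_f d \<kappa> f n t * ((-1) ^ n * gegenbauer ?\<nu> (Suc n) 1))"
    using delta_pos[OF \<nu>] by (simp add: tilde_f_Suc_Suc summable_divide_iff del: of_nat_Suc)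
  note tilde_0 = tilde_f_Suc_0[where f = f and t = t, OF Suc.prems(1) f this]
  have "(\<lambda>n. ?c n * (gegenbauer ?\<nu> (Suc n) x + (-1) ^ n * gegenbauer ?\<nu> (Suc n) 1)
        - ?c n * ((-1) ^ n * gegenbauer ?\<nu> (Suc n) 1))
      sums ((I1 ^^ Suc \<kappa>) \<phi> x t - tilde_f d (Suc \<kappa>) f 0 t)"
    unfolding tilde_0 using const Suc.prems(2) by (intro sums_diff integral summable_sums)
  hence "(\<lambda>n. ?c n * gegenbauer ?\<nu> (Suc n) x)
      sums ((I1 ^^ Suc \<kappa>) \<phi> x t - tilde_f d (Suc \<kappa>) f 0 t)"
    by (simp only: distrib_left add_diff_cancel_right')
  from sums_Suc[OF this] show ?case
    by (simp only: gegenbauer_degree_0 mult_1_right diff_add_cancel)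
qed

theorem theorem4p3:
  fixes d \<kappa> :: nat
    and \<phi> :: "real \<Rightarrow> real \<Rightarrow> real"
    and f :: "nat \<Rightarrow> real \<Rightarrow> real"
  assumes "CARD('m::finite) = d + 1"
    and "0 < \<kappa>"
    and "2 * \<kappa> < d"
    and "\<phi> \<in> pd_sphere_euclidean TYPE('m) TYPE('k::finite)"
    and "schoenberg_functions TYPE('k) d \<phi> f"
    and "\<And>t. 0 \<le> t \<Longrightarrow> (\<lambda>u. (I1 ^^ (\<kappa> - 1)) \<phi> u t) integrable_on {-1..1}"
  shows "0 < tau d \<kappa>
    \<and> (\<forall>n<\<kappa>. \<exists>\<Upsilon>>0. \<forall>i. \<bar>chi d \<kappa> n i\<bar> \<le> \<Upsilon> * gegenbauer ((real d - 1) / 2) i 1)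
    \<and> (\<forall>n<\<kappa>. \<forall>t\<ge>0. summable (\<lambda>i. (-1) ^ i * chi d \<kappa> n i * f i t))
    \<and> (\<forall>x\<in>{-1..1}. \<forall>t\<ge>0.
         (\<lambda>n. tilde_f d \<kappa> f n t * gegenbauer ((real d - 2 * real \<kappa> - 1) / 2) n x)
           sums (I1 ^^ \<kappa>) \<phi> x t)
    \<and> summable (\<lambda>n. tilde_f d \<kappa> f n 0 * gegenbauer ((real d - 2 * real \<kappa> - 1) / 2) n 1)"
proof -
  note d = assms(3)
  have pd: "\<And>n. f n \<in> pd_euclidean TYPE('k)"
    and sum0: "summable (\<lambda>n. f n 0 * gegenbauer ((real d - 1) / 2) n 1)"
    and lim: "uniform_limit ({-1..1} \<times> {0..})
       (\<lambda>N (x, t). \<Sum>n<N. f n t * gegenbauer ((real d - 1) / 2) n x)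
       (\<lambda>(x, t). \<phi> x t) sequentially"
    using assms(5) by (auto simp: schoenberg_functions_def)
  have f: "summable (\<lambda>i. \<bar>f i t\<bar> * gegenbauer ((real d - 1) / 2) i 1)" if "t \<ge> 0" for t
  proof (rule summable_comparison_test'[OF sum0])
    fix n
    have "0 \<le> gegenbauer ((real d - 1) / 2) n 1"
      using d by (intro gegenbauer_at_1_nonneg) simp
    thus "norm (\<bar>f n t\<bar> * gegenbauer ((real d - 1) / 2) n 1) \<le> f n 0 * gegenbauer ((real d - 1) / 2) n 1"
      using pd_euclidean_abs_le[OF pd that, of n] by (simp add: abs_mult mult_right_mono)
  qed
  have \<phi>: "(\<lambda>n. f n t * gegenbauer ((real d - 1) / 2) n x) sums \<phi> x t"
    if "x \<in> {-1..1}" "t \<ge> 0" for x t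
    using tendsto_uniform_limitI[OF lim, of "(x, t)"] that by (simp add: sums_def)
  have sums: "(\<lambda>n. tilde_f d \<kappa> f n t * gegenbauer (lowered_order d \<kappa>) n x) sums (I1 ^^ \<kappa>) \<phi> x t"
    if "x \<in> {-1..1}" "t \<ge> 0" for x t
    using d f \<phi> that by (intro iterated_integral_sums) auto
  moreover have "summable (\<lambda>n. tilde_f d \<kappa> f n 0 * gegenbauer (lowered_order d \<kappa>) n 1)"
    using sums[of 1 0] by (auto simp: sums_iff)
  ultimately show ?thesis
    using tau_pos[OF d] chi_bound[OF d] chi_summable[OF d _ f] by (intro conjI) simp_all
qed

end
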